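(* For every integer $m\geq 3$ there exists (for some $v$) a $3$-way $(v,3,1)$ Steiner trade of volume $m$ which is $1$-solely balanced.
   Context: Let $V$ be a set of $v$ elements and let $k,t$ be positive integers with $t<k<v$. A block is a $k$-subset of $V$. A $\mu$-way $(v,k,t)$ trade of volume $m$ is a family $T=\{T_1,\dots,T_\mu\}$ of $\mu$ pairwise disjoint collections of blocks, each $T_i$ consisting of exactly $m$ blocks, such that for every $t$-subset $S$ of $V$, the number of blocks of $T_i$ containing $S$ is the same for all $i$. It is a Steiner trade if every $t$-subset of $V$ is contained in at most one block of each $T_i$. A $\mu$-way $(v,k,t)$ Steiner trade is $t$-solely balanced if for all $1\le i<j\le\mu$, no $(t+1)$-subset of $V$ is contained both in a block of $T_i$ and in a block of $T_j$. *)

theory Defs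
  imports Main "HOL-Library.Ramsey" "HOL-Library.Disjoint_Sets"
begin

text \<open>The blocks are the elements of \<^term>\<open>nsets V k\<close>, the library's set of \<open>k\<close>-subsets of \<open>V\<close>.
  The collections \<open>T\<^sub>1, \<dots>, T\<^sub>\<mu>\<close> are given as a function on indices, of which only the
  values on \<^term>\<open>{1..\<mu>::nat}\<close> matter. Points of \<open>V\<close> need not occur in any block.\<close>

definition way_trade ::
  "nat \<Rightarrow> nat \<Rightarrow> nat \<Rightarrow> nat \<Rightarrow> nat \<Rightarrow> 'a set \<Rightarrow> (nat \<Rightarrow> 'a set set) \<Rightarrow> bool" where
  "way_trade \<mu> v k t m V T \<longleftrightarrow>
     finite V \<and> card V = v \<and> 0 < t \<and> t < k \<and> k < v \<and>
     (\<forall>i\<in>{1..\<mu>}. T i \<subseteq> nsets V k \<and> card (T i) = m) \<and>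
     disjoint_family_on T {1..\<mu>} \<and>
     (\<forall>S\<in>nsets V t. \<forall>i\<in>{1..\<mu>}. \<forall>j\<in>{1..\<mu>}.
        card {B \<in> T i. S \<subseteq> B} = card {B \<in> T j. S \<subseteq> B})"

definition steiner_trade ::
  "nat \<Rightarrow> nat \<Rightarrow> nat \<Rightarrow> nat \<Rightarrow> nat \<Rightarrow> 'a set \<Rightarrow> (nat \<Rightarrow> 'a set set) \<Rightarrow> bool" where
  "steiner_trade \<mu> v k t m V T \<longleftrightarrow>
     way_trade \<mu> v k t m V T \<and>
     (\<forall>S\<in>nsets V t. \<forall>i\<in>{1..\<mu>}. card {B \<in> T i. S \<subseteq> B} \<le> 1)"

definition solely_balanced :: "nat \<Rightarrow> nat \<Rightarrow> 'a set \<Rightarrow> (nat \<Rightarrow> 'a set set) \<Rightarrow> bool" where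
  "solely_balanced \<mu> t V T \<longleftrightarrow>
     (\<forall>i j. 1 \<le> i \<and> i < j \<and> j \<le> \<mu> \<longrightarrow>
        \<not> (\<exists>S\<in>nsets V (t + 1). (\<exists>B\<in>T i. S \<subseteq> B) \<and> (\<exists>B\<in>T j. S \<subseteq> B)))"

end

theory Submission
  imports Defs
begin

text \<open>Take three disjoint copies of the integers modulo \<open>m\<close> as points and let the \<open>i\<close>-th collection
  consist of the \<open>m\<close> translates of a transversal triple with shifts \<open>(0, i mod 3, 2 i mod 3)\<close>. Each
  collection partitions the points. Two points on different levels determine a difference modulo
  \<open>m\<close>; for \<open>i = 1, 2, 3\<close> the differences between any two fixed levels are pairwise distinct and
  vary by at most \<open>2 < m\<close>, so no pair of points is covered by two collections. (The simpler shifts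
  \<open>(0, i, 2 i)\<close> fail for \<open>m = 4\<close>.)\<close>

text \<open>Level \<open>r\<close> is the interval of naturals from \<open>r * m\<close> to
  \<open>r * m + m - 1\<close>, so \<open>div m\<close> and \<open>mod m\<close> recover the level
  and the residue of a point.\<close>

definition shift_point :: "nat \<Rightarrow> nat \<Rightarrow> nat \<Rightarrow> nat \<Rightarrow> nat" where
  "shift_point m i x r = r * m + (x + i * r mod 3) mod m"

definition shift_block :: "nat \<Rightarrow> nat \<Rightarrow> nat \<Rightarrow> nat set" where
  "shift_block m i x = shift_point m i x ` {..<3}"

lemma shift_point_div [simp]: "m > 0 \<Longrightarrow> shift_point m i x r div m = r"
  by (simp add: shift_point_def)

lemma shift_point_mod [simp]: "shift_point m i x r mod m = (x + i * r mod 3) mod m"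
  by (simp add: shift_point_def)

lemma shift_point_less:
  assumes "m > 0" "r < 3"
  shows "shift_point m i x r < 3 * m"
  using assms by (simp flip: div_less_iff_less_mult)

lemma mem_shift_block:
  assumes "m > 0"
  shows "p \<in> shift_block m i x \<longleftrightarrow> p div m < 3 \<and> p mod m = (x + i * (p div m) mod 3) mod m"
proof
  assume "p div m < 3 \<and> p mod m = (x + i * (p div m) mod 3) mod m"
  then have "p = shift_point m i x (p div m)" and "p div m < 3"
    using div_mult_mod_eq[of p m] by (simp_all add: shift_point_def)
  then show "p \<in> shift_block m i x"
    by (auto simp: shift_block_def)
qed (use assms in \<open>auto simp: shift_block_def\<close>)

lemma shift_block_in_nsets:
  assumes "m > 0"
  shows "shift_block m i x \<in> nsets {..<3 * m} 3"
proof -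
  have "inj_on (shift_point m i x) {..<3}"
    by (metis assms inj_onI shift_point_div)
  then show ?thesis
    using assms by (auto simp: nsets_def shift_block_def card_image shift_point_less)
qed

text \<open>On a fixed level the shift is a constant \<open>s\<close>, and adding \<open>s\<close>
  permutes the residues modulo \<open>m\<close>; so exactly one translate hits a given
  point.\<close>

lemma ex1_shift_block:
  assumes "m > 0" "p < 3 * m"
  shows "\<exists>!x. x < m \<and> p \<in> shift_block m i x"
proof -
  define s where "s = i * (p div m) mod 3"
  have p: "p div m < 3"
    using assms by (simp add: div_less_iff_less_mult)
  have inj: "inj_on (\<lambda>x. (x + s) mod m) {..<m}"
  proof (rule inj_onI)
    fix x y assume xy: "x \<in> {..<m}" "y \<in> {..<m}" "(x + s) mod m = (y + s) mod m"
    \<comment> \<open>Over the integers subtraction is not truncated, and \<open>s\<close>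
      cancels.\<close>
    then have "int m dvd int (x + s) - int (y + s)"
      by (metis mod_eq_dvd_iff zmod_int)
    then have "int x mod int m = int y mod int m"
      by (simp add: mod_eq_dvd_iff)
    with xy show "x = y" by simp
  qed
  then have "(\<lambda>x. (x + s) mod m) ` {..<m} = {..<m}"
    using assms by (intro endo_inj_surj) auto
  moreover have "p mod m \<in> {..<m}"
    using assms by simp
  ultimately obtain x where "x < m" "p mod m = (x + s) mod m"
    by (metis (no_types, lifting) imageE lessThan_iff)
  with inj have "\<exists>!x. x < m \<and> (x + s) mod m = p mod m"
    by (intro ex1I[of _ x]) (auto dest: inj_onD)
  moreover have "p \<in> shift_block m i x \<longleftrightarrow> (x + s) mod m = p mod m" for x
    using p by (auto simp: mem_shift_block[OF \<open>m > 0\<close>] s_def)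
  ultimately show ?thesis
    by simp
qed

text \<open>Each common point gives a congruence between \<open>x\<close> and \<open>y\<close>.
  Subtracting the two eliminates both translates and leaves a condition on the shifts alone.\<close>

lemma shift_blocks_meet_in_one_point:
  assumes m: "m \<ge> 3" and i: "i \<in> {1..3}" and j: "j \<in> {1..3}"
    and p: "p \<in> shift_block m i x" "p \<in> shift_block m j y"
    and q: "q \<in> shift_block m i x" "q \<in> shift_block m j y"
    and "p \<noteq> q"
  shows "i = j"
proof -
  define r s where "r = p div m" and "s = q div m"
  have "m > 0" using m by simp
  note mem = mem_shift_block[OF this]
  have rs: "r < 3" "s < 3"
    using p q by (auto simp: mem r_def s_def)
  \<comment> \<open>A block has only one point on each level.\<close>
  have "r \<noteq> s"
    using p q \<open>p \<noteq> q\<close> unfolding mem r_def s_def by (metis div_mult_mod_eq)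
  define d where "d = (int (i * r mod 3) - int (j * r mod 3)) - (int (i * s mod 3) - int (j * s mod 3))"
  have "(x + i * r mod 3) mod m = (y + j * r mod 3) mod m"
    "(x + i * s mod 3) mod m = (y + j * s mod 3) mod m"
    using p q by (auto simp: mem r_def s_def)
  then have "int m dvd int (x + i * r mod 3) - int (y + j * r mod 3)"
    "int m dvd int (x + i * s mod 3) - int (y + j * s mod 3)"
    by (metis mod_eq_dvd_iff zmod_int)+
  then have "int m dvd (int (x + i * r mod 3) - int (y + j * r mod 3))
      - (int (x + i * s mod 3) - int (y + j * s mod 3))"
    by (rule dvd_diff)
  then have "int m dvd d"
    by (simp add: d_def algebra_simps)
  \<comment> \<open>A finite check: the shift triples for \<open>i\<close> = 1, 2, 3 are (0,1,2),
    (0,2,1), (0,0,0). As \<open>m\<close> exceeds 2, divisibility then forces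
    \<open>d = 0\<close>.\<close>
  moreover have "i \<in> {1, 2, 3}" "j \<in> {1, 2, 3}" "r \<in> {0, 1, 2}" "s \<in> {0, 1, 2}"
    using i j rs by auto
  then have "\<bar>d\<bar> \<le> 2 \<and> (d = 0 \<longrightarrow> i = j)"
    using \<open>r \<noteq> s\<close> unfolding d_def by (elim insertE emptyE) simp_all
  ultimately show ?thesis
    using m zdvd_imp_le[of "int m" "\<bar>d\<bar>"] by fastforce
qed

theorem theorem3p8:
  fixes m :: nat
  assumes "m \<ge> 3"
  shows "\<exists>(v::nat) (V::nat set) T. steiner_trade 3 v 3 1 m V T \<and> solely_balanced 3 1 V T"
proof -
  define V where "V = {..<3 * m}"
  define T where "T i = shift_block m i ` {..<m}" for i
  have m: "m > 0" using assms by simp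
  have sub: "T i \<subseteq> nsets V 3" for i
    using shift_block_in_nsets[OF m] by (auto simp: T_def V_def)
  have inj: "inj_on (shift_block m i) {..<m}" for i
  proof (rule inj_onI)
    fix x y assume xy: "x \<in> {..<m}" "y \<in> {..<m}" "shift_block m i x = shift_block m i y"
    \<comment> \<open>Any point of the common block would do; its translate is unique.\<close>
    define p where "p = shift_point m i x 0"
    have "p < 3 * m" "p \<in> shift_block m i x"
      using m by (simp_all add: p_def shift_point_less mem_shift_block)
    moreover from this have "p \<in> shift_block m i y"
      using xy(3) by simp
    ultimately show "x = y"
      using xy(1,2) ex1_shift_block[OF m, of p i] by blast
  qed
  \<comment> \<open>The constant value 1 yields both the balance condition and the Steiner
    property.\<close>
  have count: "card {B \<in> T i. S \<subseteq> B} = 1" if S: "S \<in> nsets V 1" for i S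
  proof -
    obtain p where p: "S = {p}" "p < 3 * m"
      using S by (auto simp: nsets_def V_def card_1_singleton_iff)
    obtain x where x: "x < m \<and> p \<in> shift_block m i x"
      and unique: "\<forall>y. y < m \<and> p \<in> shift_block m i y \<longrightarrow> y = x"
      using ex1_shift_block[OF m p(2), of i] by (elim ex1E) blast
    have "{B \<in> T i. S \<subseteq> B} = {shift_block m i x}"
    proof (intro equalityI subsetI)
      fix B assume "B \<in> {B \<in> T i. S \<subseteq> B}"
      then obtain y where "y < m" "p \<in> B" "B = shift_block m i y"
        using p by (auto simp: T_def)
      with unique show "B \<in> {shift_block m i x}" by blast
    qed (use x p in \<open>simp add: T_def\<close>)
    then show ?thesis by simp
  qed
  \<comment> \<open>The blocks \<open>A\<close> and \<open>B\<close> may coincide: that case gives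
    disjointness of the collections, the general one sole balance.\<close>
  have meet: "i = j"
    if ij: "i \<in> {1..3}" "j \<in> {1..3}" and AB: "A \<in> T i" "B \<in> T j"
      and S: "S \<subseteq> A" "S \<subseteq> B" "S \<in> nsets V 2" for i j A B S
  proof -
    obtain p q where "p \<noteq> q" "S = {p, q}"
      using S(3) by (auto simp: nsets_def card_2_iff)
    moreover obtain x y where "A = shift_block m i x" "B = shift_block m j y"
      using AB by (auto simp: T_def)
    ultimately show ?thesis
      using ij S(1,2) shift_blocks_meet_in_one_point[OF assms, of i j p x y q] by simp
  qed
  have "disjoint_family_on T {1..3}"
    unfolding disjoint_family_on_def
  proof (intro ballI impI, rule ccontr)
    fix i j assume ij: "i \<in> {1..3}" "j \<in> {1..3}" "i \<noteq> j" and "T i \<inter> T j \<noteq> {}"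
    then obtain B where B: "B \<in> T i" "B \<in> T j" by blast
    \<comment> \<open>A block shared by two collections would contain a pair covered by
      both.\<close>
    then have "B \<subseteq> V" "2 \<le> card B"
      using sub[of i] by (auto simp: nsets_def)
    then obtain S where "S \<subseteq> B" "card S = 2" "finite S"
      using obtain_subset_with_card_n by metis
    with \<open>B \<subseteq> V\<close> have "S \<subseteq> B" "S \<in> nsets V 2"
      by (simp_all add: nsets_def)
    with meet[of i j B B S] ij B show False by blast
  qed
  moreover have "finite V" "card V = 3 * m"
    by (simp_all add: V_def)
  moreover have "card (T i) = m" for i
    using inj by (simp add: T_def card_image)
  ultimately have "steiner_trade 3 (3 * m) 3 1 m V T"
    using sub assms by (simp add: steiner_trade_def way_trade_def count)
  moreover have "solely_balanced 3 1 V T"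
    unfolding solely_balanced_def
  proof (intro allI impI notI)
    fix i j
    assume ij: "1 \<le> i \<and> i < j \<and> j \<le> 3"
      and "\<exists>S\<in>nsets V (1 + 1). (\<exists>B\<in>T i. S \<subseteq> B) \<and> (\<exists>B\<in>T j. S \<subseteq> B)"
    then obtain S A B where "S \<in> nsets V 2" "A \<in> T i" "S \<subseteq> A" "B \<in> T j" "S \<subseteq> B"
      unfolding one_add_one by blast
    with ij meet[of i j A B S] show False by simp
  qed
  ultimately show ?thesis by blast
qed

end
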